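(* Let $n\ge 1$, let $N$ and $V$ be finite disjoint sets with $|N|=|V|=n$, and let $Q\subseteq\mathbb{R}^{n^3}$ be the polyhedron of achievable probabilities. For every $i\in N$, $j\in V$ and $t\in[n]$ with $t\le n-1$, the inequality $$\sum_{\tau=t+1}^n\sum_{k\in N}z_{kj}^{\tau}+n\,z_{ij}^t\le 1$$ is facet-defining for $Q$.
   Context: $[n]=\{1,\dots,n\}$; singletons are identified with their element. Online bipartite matching model: $N$ is the set of impression types, $V$ the set of ads, $|N|=|V|=n$, and there are $n$ stages, counted down $t=n,n-1,\dots,1$ (stage $n$ is first; $t$ is the number of remaining decision epochs including the current one). At each stage an impression type is drawn independently and uniformly from $N$ and must be immediately and irrevocably matched to a still-available ad of $V$ or discarded; each ad is matched at most once. All pairs in $N\times V$ may be matched. Polyhedron of achievable probabilities $Q$. Consider nonnegative variables $x_{i,j}^{t,S}$ for $t\in[n]$, $i\in N$, $j\in V$, $S\subseteq V\setminus j$ with $|S|\ge t-1$ (probability that in stage $t$ type $i$ appears, the available ads are $S\cup j$, and $i$ is matched to $j$), and $y_i^{t,S}$ for $t\in[n]$, $i\in N$, $S\subseteq V$ with $|S|\ge t$ (probability that in stage $t$ type $i$ appears, the available ads are $S$, and $i$ is discarded), subject to (a) $\sum_{j\in V}x_{i,j}^{n,V\setminus j}+y_i^{n,V}\le \frac1n$ for $i\in N$; (b) $\sum_{j\in S}x_{i,j}^{t,S\setminus j}+y_i^{t,S}1_{\{t\ne1\}}-\frac1n 1_{\{|S|>t\}}\sum_{k\in N}y_k^{t+1,S}-\frac1n\sum_{k\in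 N}\sum_{j\in V\setminus S}x_{k,j}^{t+1,S}\le 0$ for $t\in[n-1]$, $i\in N$, $\emptyset\ne S\subsetneq V$ with $|S|\ge t$; (c) $\sum_{j\in V}x_{i,j}^{t,V\setminus j}+y_i^{t,V}1_{\{t\ne1\}}-\frac1n\sum_{k\in N}y_k^{t+1,V}\le0$ for $t\in[n-1]$, $i\in N$. Here $1_{\mathcal A}$ is $1$ if condition $\mathcal A$ holds and $0$ otherwise. $Q$ is the set of $z=(z_{ij}^t)_{i\in N,j\in V,t\in[n]}\in\mathbb{R}^{n^3}$ for which there is a feasible $(x,y)\ge0$ with $z_{ij}^t=\sum_{S}x_{i,j}^{t,S}$ (sum over $S\subseteq V\setminus j$ with $|S|\ge t-1$). Thus $z_{ij}^t$ is the probability that impression type $i$ is matched to ad $j$ in stage $t$ under some feasible policy. $Q$ is full-dimensional in $\mathbb{R}^{n^3}$. An inequality is facet-defining for $Q$ if it is valid for $Q$ and the set of points of $Q$ satisfying it with equality has dimension $n^3-1$. *)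

theory Defs
  imports "HOL-Analysis.Analysis"
begin

text \<open>
  The index sets are finite types: \<open>'i\<close> for the impression types, \<open>'v\<close> for the ads, and a finite
  linear order \<open>'s\<close> for the stages. Stages are counted down: \<open>stage s\<close> is the number of remaining
  decision epochs, so the largest element of \<open>'s\<close> is the first stage. The lemmas below show that
  \<open>stage\<close> identifies \<open>'s\<close> with \<open>{1..n}\<close>, where \<open>n\<close> is the number of stages.
\<close>

definition stage :: "'s::{finite,linorder} \<Rightarrow> nat" where
  "stage s = card {..s}"

lemma strict_mono_stage: "strict_mono (stage :: 's::{finite,linorder} \<Rightarrow> nat)"
  unfolding stage_def by (intro strict_monoI psubset_card_mono) auto

lemma bij_betw_stage: "bij_betw (stage :: 's::{finite,linorder} \<Rightarrow> nat) UNIV {1..CARD('s)}"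
proof -
  have inj: "inj (stage :: 's \<Rightarrow> nat)"
    using strict_mono_stage by (rule strict_mono_imp_inj_on)
  have "range (stage :: 's \<Rightarrow> nat) \<subseteq> {1..CARD('s)}"
    by (auto simp: stage_def Suc_le_eq card_gt_0_iff intro!: card_mono)
  moreover have "card (range (stage :: 's \<Rightarrow> nat)) = card {1..CARD('s)}"
    using inj by (simp add: card_image)
  ultimately have "range (stage :: 's \<Rightarrow> nat) = {1..CARD('s)}"
    by (intro card_subset_eq) auto
  with inj show ?thesis by (simp add: bij_betw_def)
qed

text \<open>
  \<open>x t S i j\<close> is the probability that in stage \<open>t\<close> type \<open>i\<close> appears, the available ads are
  \<open>S \<union> {j}\<close>, and \<open>i\<close> is matched to \<open>j\<close>; \<open>y t S i\<close> is the probability that in stage \<open>t\<close> type \<open>i\<close>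
  appears, the available ads are \<open>S\<close>, and \<open>i\<close> is discarded. Values of \<open>x\<close> and \<open>y\<close> outside the index
  ranges given by the first two conjuncts are never used.
\<close>

definition feasible ::
  "(nat \<Rightarrow> 'v::finite set \<Rightarrow> 'i::finite \<Rightarrow> 'v \<Rightarrow> real) \<Rightarrow> (nat \<Rightarrow> 'v set \<Rightarrow> 'i \<Rightarrow> real) \<Rightarrow> bool" where
  "feasible x y \<longleftrightarrow> (let n = CARD('v) in
     (\<forall>t\<in>{1..n}. \<forall>i j S. j \<notin> S \<and> t - 1 \<le> card S \<longrightarrow> 0 \<le> x t S i j) \<and>
     (\<forall>t\<in>{1..n}. \<forall>i S. t \<le> card S \<longrightarrow> 0 \<le> y t S i) \<and>
     (\<forall>i. (\<Sum>j\<in>UNIV. x n (UNIV - {j}) i j) + y n UNIV i \<le> 1 / real n) \<and>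
     (\<forall>t\<in>{1..n-1}. \<forall>i S. S \<noteq> {} \<and> S \<subset> UNIV \<and> t \<le> card S \<longrightarrow>
        (\<Sum>j\<in>S. x t (S - {j}) i j) + y t S i * of_bool (t \<noteq> 1)
        - 1 / real n * of_bool (card S > t) * (\<Sum>k\<in>UNIV. y (t + 1) S k)
        - 1 / real n * (\<Sum>k\<in>UNIV. \<Sum>j\<in>UNIV - S. x (t + 1) S k j) \<le> 0) \<and>
     (\<forall>t\<in>{1..n-1}. \<forall>i.
        (\<Sum>j\<in>UNIV. x t (UNIV - {j}) i j) + y t UNIV i * of_bool (t \<noteq> 1)
        - 1 / real n * (\<Sum>k\<in>UNIV. y (t + 1) UNIV k) \<le> 0))"

definition Q :: "(real ^ ('i::finite \<times> 'v::finite \<times> 's::{finite,linorder})) set" where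
  "Q = {z. \<exists>x y. feasible x y \<and>
          (\<forall>i j s. z $ (i, j, s) =
             (\<Sum>S | j \<notin> S \<and> stage s - 1 \<le> card S. x (stage s) S i j))}"

definition facet_defining :: "'a::euclidean_space set \<Rightarrow> ('a \<Rightarrow> real) \<Rightarrow> real \<Rightarrow> bool" where
  "facet_defining P f b \<longleftrightarrow>
     (\<forall>z\<in>P. f z \<le> b) \<and> aff_dim {z \<in> P. f z = b} = int DIM('a) - 1"

end

theory Submission
  imports Defs
begin

text \<open>
  Validity is a flow balance: if \<open>avail x y j t\<close> is the probability that ad \<open>j\<close> is still available at
  stage \<open>t\<close>, then each stage lowers it by at least the probability of matching \<open>j\<close> in that stage, and
  a fixed type is matched to \<open>j\<close> at stage \<open>t\<close> with probability at most \<open>avail x y j t / n\<close>.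
  Equality holds for every policy that gives \<open>j\<close>, whenever available, to the type \<open>i\<close> arriving at
  stage \<open>t\<close>. Policies active in two stages only already produce
  enough such points: a vector \<open>c\<close> orthogonal to all of them vanishes, coordinate by coordinate.
  Hence the face, which lies in a hyperplane missing the origin, spans the whole space linearly.
\<close>

section \<open>Validity\<close>

text \<open>The mass arriving in state \<open>S\<close> at stage \<open>t\<close>, which is n times
  the right-hand side of (a), (b) or (c). For \<open>S = UNIV\<close> the second sum is empty, so
  (c) needs no case of its own. A set of size exactly \<open>t\<close> cannot have been kept by a
  discard, since stage \<open>t + 1\<close> has at least \<open>t + 1\<close> ads; hence the
  indicator.\<close>

definition inflow ::
  "(nat \<Rightarrow> 'v::finite set \<Rightarrow> 'i::finite \<Rightarrow> 'v \<Rightarrow> real) \<Rightarrow> (nat \<Rightarrow> 'v set \<Rightarrow> 'i \<Rightarrow> real) \<Rightarrow>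
    nat \<Rightarrow> 'v set \<Rightarrow> real" where
  "inflow x y t S =
    (if t = CARD('v) then of_bool (S = UNIV)
     else of_bool (card S > t) * (\<Sum>k\<in>UNIV. y (t + 1) S k) +
       (\<Sum>k\<in>UNIV. \<Sum>j\<in>UNIV - S. x (t + 1) S k j))"

definition avail ::
  "(nat \<Rightarrow> 'v::finite set \<Rightarrow> 'i::finite \<Rightarrow> 'v \<Rightarrow> real) \<Rightarrow> (nat \<Rightarrow> 'v set \<Rightarrow> 'i \<Rightarrow> real) \<Rightarrow>
    'v \<Rightarrow> nat \<Rightarrow> real" where
  "avail x y j t = (\<Sum>S | j \<in> S \<and> t \<le> card S. inflow x y t S)"

text \<open>Puts (a), (b) and (c) into one form, so that later arguments need no distinction between
  the first stage, proper subsets and the full set.\<close>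

lemma outflow_le_inflow:
  fixes x :: "nat \<Rightarrow> 'v::finite set \<Rightarrow> 'i::finite \<Rightarrow> 'v \<Rightarrow> real"
  assumes "feasible x y" "1 \<le> t" "t \<le> card S"
  shows "(\<Sum>j\<in>S. x t (S - {j}) i j) + y t S i * of_bool (t \<noteq> 1) \<le> inflow x y t S / CARD('v)"
proof -
  have cS: "card S \<le> CARD('v)" by (simp add: card_mono)
  consider "t = CARD('v)" | "t < CARD('v)" "S \<noteq> UNIV" | "t < CARD('v)" "S = UNIV"
    using cS assms(3) by linarith
  then show ?thesis
  proof cases
    case 1
    have S: "S = UNIV" using 1 assms(3) cS by (intro card_subset_eq) auto
    have "(\<Sum>j\<in>UNIV. x CARD('v) (UNIV - {j}) i j) + y CARD('v) UNIV i \<le> 1 / CARD('v)"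
      and "0 \<le> y CARD('v) UNIV i"
      using assms(1,2) 1 unfolding feasible_def Let_def by auto
    \<comment> \<open>Constraint (a) carries no indicator on \<open>y\<close>; the two forms differ
      only for n = 1, where nonnegativity allows the term to be dropped.\<close>
    moreover have "y CARD('v) UNIV i * of_bool (CARD('v) \<noteq> 1) \<le> y CARD('v) UNIV i"
      using calculation(2) by (cases "CARD('v) = 1") auto
    ultimately have "(\<Sum>j\<in>UNIV. x CARD('v) (UNIV - {j}) i j)
        + y CARD('v) UNIV i * of_bool (CARD('v) \<noteq> 1) \<le> 1 / CARD('v)"
      by linarith
    then show ?thesis
      unfolding S 1 by (simp add: inflow_def)
  next
    case 2
    have "S \<noteq> {}" using assms by auto
    moreover have "t \<in> {1..CARD('v) - 1}" "S \<subset> UNIV" using 2 assms by auto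
    ultimately have "(\<Sum>j\<in>S. x t (S - {j}) i j) + y t S i * of_bool (t \<noteq> 1)
        - 1 / real CARD('v) * of_bool (card S > t) * (\<Sum>k\<in>UNIV. y (t + 1) S k)
        - 1 / real CARD('v) * (\<Sum>k\<in>UNIV. \<Sum>j\<in>UNIV - S. x (t + 1) S k j) \<le> 0"
      using assms(1,3) unfolding feasible_def Let_def by blast
    then show ?thesis
      using 2 by (simp add: inflow_def add_divide_distrib)
  next
    case 3
    have "t \<in> {1..CARD('v) - 1}" using 3 assms by auto
    then have "(\<Sum>j\<in>UNIV. x t (UNIV - {j}) i j) + y t UNIV i * of_bool (t \<noteq> 1)
        - 1 / real CARD('v) * (\<Sum>k\<in>UNIV. y (t + 1) UNIV k) \<le> 0"
      using assms(1) unfolding feasible_def Let_def by blast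
    then show ?thesis
      using 3 by (simp add: inflow_def)
  qed
qed

text \<open>The variables \<open>x\<close> are indexed by the ads left after a match,
  \<open>inflow\<close> by those present before it; adding or removing \<open>j\<close>
  translates.\<close>

lemma sum_sets_remove:
  fixes f :: "'v::finite set \<Rightarrow> 'a::comm_monoid_add"
  assumes "1 \<le> t"
  shows "(\<Sum>S | j \<notin> S \<and> t - 1 \<le> card S. f S) = (\<Sum>S | j \<in> S \<and> t \<le> card S. f (S - {j}))"
  using assms
  by (intro sum.reindex_bij_witness[where i = "\<lambda>S. S - {j}" and j = "insert j"])
     (auto simp: insert_absorb card_Diff_singleton_if)

text \<open>In each state containing \<open>j\<close>, the match of \<open>i\<close> to
  \<open>j\<close> is one nonnegative part of the outflow of type \<open>i\<close>, which is at most
  a 1/n share of the inflow.\<close>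

lemma card_mult_match_le_avail:
  fixes x :: "nat \<Rightarrow> 'v::finite set \<Rightarrow> 'i::finite \<Rightarrow> 'v \<Rightarrow> real"
  assumes "feasible x y" "1 \<le> t" "t \<le> CARD('v)"
  shows "CARD('v) * (\<Sum>S | j \<notin> S \<and> t - 1 \<le> card S. x t S i j) \<le> avail x y j t"
proof -
  have "CARD('v) * (\<Sum>S | j \<in> S \<and> t \<le> card S. x t (S - {j}) i j)
      = (\<Sum>S | j \<in> S \<and> t \<le> card S. CARD('v) * x t (S - {j}) i j)"
    by (simp add: sum_distrib_left)
  also have "\<dots> \<le> (\<Sum>S | j \<in> S \<and> t \<le> card S. inflow x y t S)"
  proof (rule sum_mono)
    fix S assume "S \<in> {S. j \<in> S \<and> t \<le> card S}"
    then have S: "j \<in> S" "t \<le> card S" by auto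
    have nn: "0 \<le> x t (S - {l}) i l" if "l \<in> S" for l
      using assms S that unfolding feasible_def Let_def by (auto simp: card_Diff_singleton_if)
    have y: "0 \<le> y t S i"
      using assms S unfolding feasible_def Let_def by auto
    have "x t (S - {j}) i j \<le> (\<Sum>j\<in>S. x t (S - {j}) i j)"
      using S nn by (intro member_le_sum) auto
    also have "\<dots> \<le> (\<Sum>j\<in>S. x t (S - {j}) i j) + y t S i * of_bool (t \<noteq> 1)"
      using y by simp
    also have "\<dots> \<le> inflow x y t S / CARD('v)"
      using outflow_le_inflow[OF assms(1,2)] S by blast
    finally show "CARD('v) * x t (S - {j}) i j \<le> inflow x y t S"
      by (simp add: field_simps)
  qed
  finally show ?thesis unfolding sum_sets_remove[OF assms(2)] avail_def .
qed

text \<open>The outflow at stage \<open>t + 1\<close> from states containing \<open>j\<close>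
  consists of discards, matches to \<open>j\<close> and matches to other ads. The first and third
  kinds lead exactly to the states containing \<open>j\<close> at stage \<open>t\<close>; the second
  is the loss being counted.\<close>

lemma avail_step:
  fixes x :: "nat \<Rightarrow> 'v::finite set \<Rightarrow> 'i::finite \<Rightarrow> 'v \<Rightarrow> real"
  assumes "feasible x y" "1 \<le> t" "t < CARD('v)" and n: "CARD('i) = CARD('v)"
  shows "avail x y j t + (\<Sum>k\<in>UNIV. \<Sum>S | j \<notin> S \<and> t \<le> card S. x (t + 1) S k j)
           \<le> avail x y j (t + 1)"
proof -
  let ?A = "\<lambda>t. {S. j \<in> S \<and> t \<le> card S}"
  let ?T = "t + 1"
  \<comment> \<open>Summing over the n types cancels the factor 1/n, and since \<open>t + 1\<close>
    is not 1 the indicator on \<open>y\<close> disappears.\<close>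
  have out: "(\<Sum>k\<in>UNIV. (\<Sum>l\<in>S. x ?T (S - {l}) k l) + y ?T S k) \<le> inflow x y ?T S"
    if "S \<in> ?A ?T" for S
  proof -
    have "(\<Sum>k\<in>UNIV. (\<Sum>l\<in>S. x ?T (S - {l}) k l) + y ?T S k)
        \<le> (\<Sum>k\<in>(UNIV :: 'i set). inflow x y ?T S / CARD('v))"
      using outflow_le_inflow[OF assms(1), of ?T S] that assms(2) by (intro sum_mono) auto
    then show ?thesis by (simp add: n)
  qed
  have split: "(\<Sum>l\<in>S. x ?T (S - {l}) k l)
      = x ?T (S - {j}) k j + (\<Sum>l\<in>S - {j}. x ?T (S - {l}) k l)" if "S \<in> ?A ?T" for S k
    using that by (intro sum.remove) auto
  \<comment> \<open>A state \<open>S\<close> containing \<open>j\<close> that is reached by using up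
    \<open>l\<close> came from \<open>insert l S\<close>, with \<open>l\<close> different from
    \<open>j\<close>.\<close>
  have xpart: "(\<Sum>S\<in>?A t. \<Sum>l\<in>UNIV - S. x ?T S k l)
      = (\<Sum>S\<in>?A ?T. \<Sum>l\<in>S - {j}. x ?T (S - {l}) k l)" for k
  proof -
    have "(\<Sum>(S, l)\<in>Sigma (?A t) (\<lambda>S. UNIV - S). x ?T S k l)
        = (\<Sum>(S, l)\<in>Sigma (?A ?T) (\<lambda>S. S - {j}). x ?T (S - {l}) k l)"
      by (intro sum.reindex_bij_witness[where i = "\<lambda>(S, l). (S - {l}, l)"
            and j = "\<lambda>(S, l). (insert l S, l)"])
         (auto simp: insert_absorb card_Diff_singleton_if)
    then show ?thesis by (simp add: sum.Sigma)
  qed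
  have ypart: "(\<Sum>S\<in>?A t. of_bool (card S > t) * (\<Sum>k\<in>UNIV. y ?T S k))
      = (\<Sum>S\<in>?A ?T. \<Sum>k\<in>UNIV. y ?T S k)"
    by (rule sum.mono_neutral_cong_right) auto
  have "avail x y j t = (\<Sum>S\<in>?A ?T. \<Sum>k\<in>UNIV. y ?T S k)
      + (\<Sum>k\<in>UNIV. \<Sum>S\<in>?A t. \<Sum>l\<in>UNIV - S. x ?T S k l)"
    using assms(3) ypart sum.swap[of "\<lambda>S k. \<Sum>l\<in>UNIV - S. x ?T S k l" UNIV "?A t"]
    by (simp add: avail_def inflow_def sum.distrib)
  also have "\<dots> = (\<Sum>S\<in>?A ?T. \<Sum>k\<in>UNIV. y ?T S k)
      + (\<Sum>S\<in>?A ?T. \<Sum>k\<in>UNIV. \<Sum>l\<in>S - {j}. x ?T (S - {l}) k l)"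
    by (simp only: xpart sum.swap[of _ "?A ?T" UNIV])
  finally have B: "avail x y j t = \<dots>" .
  have "(\<Sum>k\<in>UNIV. \<Sum>S | j \<notin> S \<and> t \<le> card S. x ?T S k j)
      = (\<Sum>S\<in>?A ?T. \<Sum>k\<in>UNIV. x ?T (S - {j}) k j)"
    using sum_sets_remove[where t = ?T and j = j and f = "\<lambda>S. x ?T S _ j"]
    by (simp, intro sum.swap)
  moreover have "(\<Sum>S\<in>?A ?T. \<Sum>k\<in>UNIV. (\<Sum>l\<in>S. x ?T (S - {l}) k l) + y ?T S k) =
      (\<Sum>S\<in>?A ?T. (\<Sum>k\<in>UNIV. x ?T (S - {j}) k j) +
        (\<Sum>k\<in>UNIV. \<Sum>l\<in>S - {j}. x ?T (S - {l}) k l) + (\<Sum>k\<in>UNIV. y ?T S k))"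
    by (intro sum.cong refl) (simp only: split sum.distrib)
  ultimately have "avail x y j t + (\<Sum>k\<in>UNIV. \<Sum>S | j \<notin> S \<and> t \<le> card S. x ?T S k j)
      = (\<Sum>S\<in>?A ?T. \<Sum>k\<in>UNIV. (\<Sum>l\<in>S. x ?T (S - {l}) k l) + y ?T S k)"
    using B by (simp only: sum.distrib ac_simps)
  also have "\<dots> \<le> avail x y j ?T"
    unfolding avail_def using out by (rule sum_mono)
  finally show ?thesis .
qed

text \<open>Telescopes \<open>avail_step\<close> from the first stage down to \<open>t\<close>,
  starting from the value 1 at stage n, where all mass sits on the full set.\<close>

lemma avail_le:
  fixes x :: "nat \<Rightarrow> 'v::finite set \<Rightarrow> 'i::finite \<Rightarrow> 'v \<Rightarrow> real"
  assumes "feasible x y" "1 \<le> t" "t \<le> CARD('v)" and n: "CARD('i) = CARD('v)"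
  shows "avail x y j t +
    (\<Sum>m\<in>{t<..CARD('v)}. \<Sum>k\<in>UNIV. \<Sum>S | j \<notin> S \<and> m - 1 \<le> card S. x m S k j) \<le> 1"
  using assms(3,2)
proof (induction rule: inc_induct)
  case base
  have "avail x y j CARD('v) = (\<Sum>S\<in>{UNIV}. inflow x y CARD('v) S)"
    unfolding avail_def
    by (rule sum.mono_neutral_right) (auto simp: inflow_def)
  then show ?case by (simp add: inflow_def)
next
  case (step m)
  have "{m<..CARD('v)} = insert (m + 1) {Suc m<..CARD('v)}"
    using step.hyps by auto
  then show ?case
    using step avail_step[OF assms(1) step.prems step.hyps(2) n, of j] by simp
qed

lemma sum_stages_greater:
  fixes t :: "'s::{finite,linorder}"
  shows "(\<Sum>\<tau>\<in>{t<..}. f (stage \<tau>)) = (\<Sum>m\<in>{stage t<..CARD('s)}. f m)"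
proof (rule sum.reindex_bij_betw)
  have "stage ` {t<..} = {stage t<..CARD('s)}"
  proof (intro set_eqI iffI)
    fix m assume "m \<in> stage ` {t<..}"
    then show "m \<in> {stage t<..CARD('s)}"
      using bij_betw_stage[where 's = 's] strict_mono_less[OF strict_mono_stage, of t]
      by (auto simp: bij_betw_def)
  next
    fix m assume m: "m \<in> {stage t<..CARD('s)}"
    then obtain \<tau> :: 's where "m = stage \<tau>"
      using bij_betw_stage[where 's = 's] by (force simp: bij_betw_def)
    then show "m \<in> stage ` {t<..}"
      using m strict_mono_less[OF strict_mono_stage, of t \<tau>] by auto
  qed
  then show "bij_betw stage {t<..} {stage t<..CARD('s)}"
    using inj_on_subset[OF strict_mono_imp_inj_on[OF strict_mono_stage]] by (auto simp: bij_betw_def)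
qed

lemma stage_bounds:
  fixes s :: "'s::{finite,linorder}"
  shows "1 \<le> stage s" "stage s \<le> CARD('s)"
  using bij_betw_stage[where 's = 's] by (auto simp: bij_betw_def)

text \<open>The availability of \<open>j\<close> at stage \<open>t\<close> is at least the term for
  stage \<open>t\<close> and at most 1 minus the matches made to \<open>j\<close> before.\<close>

lemma Q_valid:
  fixes z :: "real ^ ('i::finite \<times> 'v::finite \<times> 's::{finite,linorder})"
  assumes "z \<in> Q" "CARD('i) = CARD('v)" "CARD('s) = CARD('v)"
  shows "(\<Sum>\<tau>\<in>{t<..}. \<Sum>k\<in>UNIV. z $ (k, j, \<tau>)) + real CARD('v) * z $ (i, j, t) \<le> 1"
proof -
  obtain x y where f: "feasible x y" and z: "\<And>i j s. z $ (i, j, s) =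
      (\<Sum>S | j \<notin> S \<and> stage s - 1 \<le> card S. x (stage s) S i j)"
    using assms(1) unfolding Q_def by blast
  have t: "1 \<le> stage t" "stage t \<le> CARD('v)" using stage_bounds[of t] assms by auto
  have "(\<Sum>\<tau>\<in>{t<..}. \<Sum>k\<in>UNIV. z $ (k, j, \<tau>)) =
    (\<Sum>m\<in>{stage t<..CARD('v)}. \<Sum>k\<in>UNIV. \<Sum>S | j \<notin> S \<and> m - 1 \<le> card S. x m S k j)"
    unfolding z assms(3)[symmetric] by (rule sum_stages_greater)
  then show ?thesis
    using avail_le[OF f t assms(2), where j = j]
      card_mult_match_le_avail[OF f t, where j = j and i = i]
    by (simp add: z)
qed

section \<open>Policies\<close>

text \<open>A policy maps the stage, the available ads and the arriving type to the ad to be used;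
  \<open>state_prob \<sigma> m\<close> is the distribution of the available ads after \<open>m\<close> stages, that is at stage
  \<open>n - m\<close>. An answer outside the available ads counts as lost mass, which the inequalities defining
  \<open>feasible\<close> permit.\<close>

primrec state_prob ::
  "(nat \<Rightarrow> 'v::finite set \<Rightarrow> 'i::finite \<Rightarrow> 'v option) \<Rightarrow> nat \<Rightarrow> 'v set \<Rightarrow> real" where
  "state_prob \<sigma> 0 S = of_bool (S = UNIV)"
| "state_prob \<sigma> (Suc m) S = 1 / CARD('v) *
    (\<Sum>k\<in>UNIV. of_bool (\<sigma> (CARD('v) - m) S k = None) * state_prob \<sigma> m S +
      (\<Sum>j\<in>UNIV - S. of_bool (\<sigma> (CARD('v) - m) (insert j S) k = Some j) *
        state_prob \<sigma> m (insert j S)))"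

lemma state_prob_nonneg: "0 \<le> state_prob \<sigma> m S"
proof (induction m arbitrary: S)
  case (Suc m)
  then show ?case
    unfolding state_prob.simps
    by (intro mult_nonneg_nonneg sum_nonneg add_nonneg_nonneg) auto
qed simp

text \<open>Each stage uses up at most one ad.\<close>

lemma state_prob_eq_0:
  fixes S :: "'v::finite set"
  assumes "card S + m < CARD('v)"
  shows "state_prob \<sigma> m S = 0"
  using assms
proof (induction m arbitrary: S)
  case (Suc m)
  then have "state_prob \<sigma> m (insert j S) = 0" if "j \<notin> S" for j
    using that by simp
  then show ?case using Suc by simp
qed auto

text \<open>Restricting to \<open>l \<in> S\<close> drops answers outside the available ads. No
  lower bound on \<open>card S\<close> is imposed, as smaller sets carry no mass by
  \<open>state_prob_eq_0\<close>.\<close>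

definition policy_point ::
  "(nat \<Rightarrow> 'v::finite set \<Rightarrow> 'i::finite \<Rightarrow> 'v option) \<Rightarrow>
    real ^ ('i \<times> 'v \<times> 's::{finite,linorder})" where
  "policy_point \<sigma> = (\<chi> p. case p of (k, l, s) \<Rightarrow> 1 / CARD('v) *
    (\<Sum>S | l \<in> S. of_bool (\<sigma> (stage s) S k = Some l) * state_prob \<sigma> (CARD('v) - stage s) S))"

text \<open>A policy gives a single answer, so at most one summand survives; none does if the answer
  is an ad outside \<open>S\<close>.\<close>

lemma sum_of_bool_Some_le:
  fixes p :: real
  assumes "0 \<le> p"
  shows "(\<Sum>j\<in>(S::'v::finite set). of_bool (u = Some j) * p) + of_bool (u = None) * p \<le> p"
  using assms by (cases u) (auto simp: of_bool_def if_distrib[of "\<lambda>c. c * p"] sum.delta cong: if_cong)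

lemma policy_point_in_Q:
  fixes \<sigma> :: "nat \<Rightarrow> 'v::finite set \<Rightarrow> 'i::finite \<Rightarrow> 'v option"
  assumes n: "CARD('s::{finite,linorder}) = CARD('v)"
  shows "(policy_point \<sigma> :: real ^ ('i \<times> 'v \<times> 's)) \<in> Q"
proof -
  let ?n = "CARD('v)"
  define P where "P t = state_prob \<sigma> (?n - t)" for t
  \<comment> \<open>The witnesses are the joint probabilities of arrival, state and action;
    \<open>S\<close> being what remains after the match, the state before it is
    \<open>insert j S\<close>.\<close>
  define x where "x t S i j = 1 / ?n * (of_bool (\<sigma> t (insert j S) i = Some j) * P t (insert j S))"
    for t S i j
  define y where "y t S i = 1 / ?n * (of_bool (\<sigma> t S i = None) * P t S)" for t S i
  have P0: "0 \<le> P t S" for t S by (simp add: P_def state_prob_nonneg)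
  have Pn: "P ?n S = of_bool (S = UNIV)" for S by (simp add: P_def)
  have Pz: "P t S = 0" if "card S < t" "t \<le> ?n" for t S
    using that by (simp add: P_def state_prob_eq_0)
  have out: "(\<Sum>j\<in>S. x t (S - {j}) i j) + y t S i \<le> 1 / ?n * P t S" for t S i
  proof -
    have "(\<Sum>j\<in>S. x t (S - {j}) i j) + y t S i =
      1 / ?n * ((\<Sum>j\<in>S. of_bool (\<sigma> t S i = Some j) * P t S) + of_bool (\<sigma> t S i = None) * P t S)"
      by (simp add: x_def y_def insert_absorb distrib_left sum_distrib_left
          del: sum_of_bool_mult_eq sum_mult_of_bool_eq)
    also have "\<dots> \<le> 1 / ?n * P t S"
      by (intro mult_left_mono sum_of_bool_Some_le P0) auto
    finally show ?thesis .
  qed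
  have y0: "0 \<le> y t S i" for t S i by (simp add: y_def P0)
  have out': "(\<Sum>j\<in>S. x t (S - {j}) i j) + y t S i * of_bool (t \<noteq> 1) \<le> 1 / ?n * P t S" for t S i
    using out[where t = t and S = S and i = i] y0[of t S i] by (cases "t = 1") auto
  \<comment> \<open>The recursion of \<open>state_prob\<close>, expressed through \<open>x\<close>
    and \<open>y\<close>, is the inflow term of (b) and (c). The indicator changes nothing, because
    a set of size \<open>t\<close> has no mass at stage \<open>t + 1\<close>.\<close>
  have rec: "P t S = of_bool (card S > t) * (\<Sum>k\<in>UNIV. y (t + 1) S k)
      + (\<Sum>k\<in>UNIV. \<Sum>j\<in>UNIV - S. x (t + 1) S k j)" if "t < ?n" "t \<le> card S" for t S
  proof -
    have e: "?n - t = Suc (?n - (t + 1))" "?n - (?n - (t + 1)) = t + 1" using that by auto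
    have "P t S = (\<Sum>k\<in>UNIV. y (t + 1) S k) + (\<Sum>k\<in>UNIV. \<Sum>j\<in>UNIV - S. x (t + 1) S k j)"
      unfolding P_def[of t] e(1) state_prob.simps e(2)
      by (simp add: P_def x_def y_def sum.distrib sum_distrib_left distrib_left
          del: sum_of_bool_mult_eq sum_mult_of_bool_eq sum_of_bool_eq)
    moreover have "(\<Sum>k\<in>UNIV. y (t + 1) S k) = 0" if "\<not> card S > t"
      using Pz[of S "t + 1"] \<open>t < ?n\<close> that by (simp add: y_def)
    ultimately show ?thesis by auto
  qed
  have "feasible x y"
    unfolding feasible_def Let_def
  proof (intro conjI ballI allI impI)
    fix i
    show "(\<Sum>j\<in>UNIV. x ?n (UNIV - {j}) i j) + y ?n UNIV i \<le> 1 / real ?n"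
      using out[where t = ?n and S = UNIV and i = i] by (simp add: Pn)
  next
    fix t i and S :: "'v set"
    assume "t \<in> {1..?n - 1}" and S: "S \<noteq> {} \<and> S \<subset> UNIV \<and> t \<le> card S"
    then have "t < ?n" by auto
    then show "(\<Sum>j\<in>S. x t (S - {j}) i j) + y t S i * of_bool (t \<noteq> 1)
        - 1 / real ?n * of_bool (card S > t) * (\<Sum>k\<in>UNIV. y (t + 1) S k)
        - 1 / real ?n * (\<Sum>k\<in>UNIV. \<Sum>j\<in>UNIV - S. x (t + 1) S k j) \<le> 0"
      using out'[where t = t and S = S and i = i] rec[of t S] S
      by (simp only: distrib_left mult.assoc simp_thms)
  next
    fix t i assume "t \<in> {1..?n - 1}"
    then have "t < ?n" by auto
    then show "(\<Sum>j\<in>UNIV. x t (UNIV - {j}) i j) + y t UNIV i * of_bool (t \<noteq> 1)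
        - 1 / real ?n * (\<Sum>k\<in>UNIV. y (t + 1) UNIV k) \<le> 0"
      using out'[where t = t and S = UNIV and i = i] rec[of t UNIV] by simp
  qed (auto simp: x_def P0 y0)
  moreover have "policy_point \<sigma> $ (k, l, s) =
      (\<Sum>S | l \<notin> S \<and> stage s - 1 \<le> card S. x (stage s) S k l)" for k l and s :: 's
  proof -
    have s: "1 \<le> stage s" "stage s \<le> ?n" using stage_bounds[of s] n by auto
    have "(\<Sum>S | l \<notin> S \<and> stage s - 1 \<le> card S. x (stage s) S k l)
        = (\<Sum>S | l \<in> S \<and> stage s \<le> card S. x (stage s) (S - {l}) k l)"
      using s by (intro sum_sets_remove)
    also have "\<dots> = (\<Sum>S | l \<in> S. 1 / ?n * (of_bool (\<sigma> (stage s) S k = Some l) * P (stage s) S))"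
      using s by (intro sum.mono_neutral_cong_left) (auto simp: x_def insert_absorb, metis Pz not_le)
    finally show ?thesis by (simp add: policy_point_def P_def sum_distrib_left
          del: sum_of_bool_mult_eq sum_mult_of_bool_eq sum_of_bool_eq)
  qed
  ultimately show ?thesis unfolding Q_def by blast
qed


section \<open>Policies active in two stages only\<close>

lemma state_prob_Suc_discard:
  fixes \<sigma> :: "nat \<Rightarrow> 'v::finite set \<Rightarrow> 'i::finite \<Rightarrow> 'v option"
  assumes "CARD('i) = CARD('v)" "\<And>S k. \<sigma> (CARD('v) - m) S k = None"
  shows "state_prob \<sigma> (Suc m) = state_prob \<sigma> m"
  using assms by (intro ext) simp

lemma state_prob_discard:
  fixes \<sigma> :: "nat \<Rightarrow> 'v::finite set \<Rightarrow> 'i::finite \<Rightarrow> 'v option"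
  assumes "CARD('i) = CARD('v)" "m \<le> m'"
    and "\<And>r S k. m \<le> r \<Longrightarrow> r < m' \<Longrightarrow> \<sigma> (CARD('v) - r) S k = None"
  shows "state_prob \<sigma> m' = state_prob \<sigma> m"
  using assms(2,3)
proof (induction rule: dec_induct)
  case (step r)
  then have "state_prob \<sigma> (Suc r) = state_prob \<sigma> r"
    by (intro state_prob_Suc_discard assms(1)) auto
  then show ?case using step by auto
qed simp

text \<open>\<open>UNIV - set_option (g k)\<close> is the state left by an arrival of
  \<open>k\<close>, covering discard and match at once.\<close>

lemma state_prob_Suc_UNIV:
  fixes \<sigma> :: "nat \<Rightarrow> 'v::finite set \<Rightarrow> 'i::finite \<Rightarrow> 'v option"
  assumes "\<And>S. state_prob \<sigma> m S = of_bool (S = UNIV)"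
    and "\<And>S k. \<sigma> (CARD('v) - m) S k = g k"
  shows "state_prob \<sigma> (Suc m) S = 1 / CARD('v) *
    (\<Sum>k\<in>UNIV. of_bool (S = UNIV - set_option (g k)))"
proof -
  have "of_bool (g k = None) * of_bool (S = UNIV) +
      (\<Sum>j\<in>UNIV - S. of_bool (g k = Some j) * of_bool (insert j S = UNIV))
      = (of_bool (S = UNIV - set_option (g k)) :: real)" for k
  proof (cases "g k")
    case (Some l)
    have "(\<Sum>j\<in>UNIV - S. of_bool (g k = Some j) * of_bool (insert j S = UNIV))
      = (\<Sum>j\<in>UNIV - S. if l = j then of_bool (insert l S = UNIV) else (0::real))"
      by (intro sum.cong) (auto simp: Some insert_commute)
    also have "\<dots> = of_bool (S = UNIV - {l})"
      by (subst sum.delta') auto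
    finally show ?thesis by (simp add: Some)
  qed simp
  then show ?thesis
    unfolding state_prob.simps assms by simp
qed

text \<open>Used with \<open>s2 < s1\<close>, so \<open>s1\<close> comes first in time. All ads are
  then still present, which is why \<open>g1\<close> does not take the state as an argument.\<close>

definition two_stage ::
  "'s::{finite,linorder} \<Rightarrow> 's \<Rightarrow> ('i \<Rightarrow> 'v option) \<Rightarrow> ('v set \<Rightarrow> 'i \<Rightarrow> 'v option) \<Rightarrow>
    nat \<Rightarrow> 'v set \<Rightarrow> 'i \<Rightarrow> 'v option" where
  "two_stage s1 s2 g1 g2 m S k =
    (if m = stage s1 then g1 k else if m = stage s2 then g2 S k else None)"

definition match_vec ::
  "'s \<Rightarrow> 'i \<Rightarrow> 'v option \<Rightarrow> real ^ ('i::finite \<times> 'v::finite \<times> 's::finite)" where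
  "match_vec s k u = (case u of None \<Rightarrow> 0 | Some l \<Rightarrow> axis (k, l, s) 1)"

lemma match_vec_nth:
  "match_vec s k u $ (k', l, s') = of_bool (s' = s \<and> k' = k \<and> u = Some l)"
  by (auto simp: match_vec_def axis_def split: option.splits)

lemma inner_match_vec:
  "c \<bullet> match_vec s k u = (case u of None \<Rightarrow> 0 | Some l \<Rightarrow> c $ (k, l, s))"
  by (simp add: match_vec_def inner_axis split: option.splits)

text \<open>Conditions on the type \<open>k'\<close> arriving at \<open>s1\<close>: it fixes the
  state seen at \<open>s2\<close>. Two independent uniform arrivals give the factor 1/n^2.\<close>

lemma two_stage_point_nth:
  fixes s1 s2 :: "'s::{finite,linorder}" and g1 :: "'i::finite \<Rightarrow> 'v::finite option"
  assumes "s2 < s1" and n: "CARD('i) = CARD('v)" "CARD('s) = CARD('v)"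
    and g2: "\<And>S k l. g2 S k = Some l \<Longrightarrow> l \<in> S"
  shows "policy_point (two_stage s1 s2 g1 g2) $ (k, l, s) =
    1 / CARD('v) * of_bool (s = s1 \<and> g1 k = Some l) +
    1 / CARD('v)^2 * (\<Sum>k'\<in>UNIV. of_bool (s = s2 \<and> g2 (UNIV - set_option (g1 k')) k = Some l))"
proof -
  let ?\<sigma> = "two_stage s1 s2 g1 g2" and ?n = "CARD('v)"
  have st: "stage s2 < stage s1" "stage s1 \<le> ?n"
    using assms(1) strict_mono_less[OF strict_mono_stage] stage_bounds[of s1] n by auto
  have "state_prob ?\<sigma> (?n - stage s1) = state_prob ?\<sigma> 0"
    using st by (intro state_prob_discard n) (auto simp: two_stage_def)
  then have P1: "state_prob ?\<sigma> (?n - stage s1) S = of_bool (S = UNIV)" for S by simp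
  have "state_prob ?\<sigma> (?n - stage s2) = state_prob ?\<sigma> (Suc (?n - stage s1))"
    using st by (intro state_prob_discard n) (auto simp: two_stage_def)
  then have P2: "state_prob ?\<sigma> (?n - stage s2) S
      = 1 / ?n * (\<Sum>k\<in>UNIV. of_bool (S = UNIV - set_option (g1 k)))" for S
    using st state_prob_Suc_UNIV[of ?\<sigma>, OF P1, of g1] by (simp add: two_stage_def)
  consider "s = s1" | "s = s2" | "s \<noteq> s1" "s \<noteq> s2" by blast
  then show ?thesis
  proof cases
    case 1
    have "(\<Sum>S | l \<in> S. of_bool (g1 k = Some l) * of_bool (S = (UNIV :: 'v set)))
      = (\<Sum>S\<in>{UNIV :: 'v set}. of_bool (g1 k = Some l) :: real)"
      by (rule sum.mono_neutral_cong_right) auto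
    then show ?thesis
      using 1 less_imp_neq[OF assms(1)] by (simp add: policy_point_def two_stage_def P1
        del: sum_of_bool_mult_eq sum_mult_of_bool_eq sum_of_bool_eq)
  next
    case 2
    have "(\<Sum>S | l \<in> S. of_bool (g2 S k = Some l) *
        (\<Sum>k'\<in>UNIV. of_bool (S = UNIV - set_option (g1 k'))))
      = (\<Sum>k'\<in>UNIV. \<Sum>S | l \<in> S. of_bool (g2 S k = Some l) *
          (of_bool (S = UNIV - set_option (g1 k')) :: real))"
      by (simp only: sum_distrib_left) (rule sum.swap)
    also have "\<dots> = (\<Sum>k'\<in>UNIV. of_bool (g2 (UNIV - set_option (g1 k')) k = Some l))"
    proof (rule sum.cong[OF refl])
      fix k'
      let ?R = "UNIV - set_option (g1 k')"
      have "(\<Sum>S | l \<in> S. of_bool (g2 S k = Some l) * (of_bool (S = ?R) :: real))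
        = (\<Sum>S | l \<in> S. if S = ?R then of_bool (g2 ?R k = Some l) else 0)"
        by (intro sum.cong) auto
      also have "\<dots> = of_bool (g2 ?R k = Some l)"
        using g2[of ?R k l] by (subst sum.delta) auto
      finally show "(\<Sum>S | l \<in> S. of_bool (g2 S k = Some l) * (of_bool (S = ?R) :: real))
        = of_bool (g2 ?R k = Some l)" .
    qed
    finally have "(\<Sum>S | l \<in> S. of_bool (g2 S k = Some l) *
        (1 / ?n * (\<Sum>k'\<in>UNIV. of_bool (S = UNIV - set_option (g1 k')))))
      = 1 / ?n * (\<Sum>k'\<in>UNIV. of_bool (g2 (UNIV - set_option (g1 k')) k = Some l))"
      unfolding mult.left_commute[of _ "1 / ?n"] sum_distrib_left[symmetric] by (rule arg_cong)
    moreover have "policy_point ?\<sigma> $ (k, l, s) = 1 / ?n * (\<Sum>S | l \<in> S.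
        of_bool (g2 S k = Some l) *
        (1 / ?n * (\<Sum>k'\<in>UNIV. of_bool (S = UNIV - set_option (g1 k')))))"
      unfolding P2[symmetric] using 2 st by (simp add: policy_point_def two_stage_def)
    ultimately show ?thesis
      using 2 less_imp_neq[OF assms(1)] by (simp add: power2_eq_square)
  next
    case 3
    then have "stage s \<noteq> stage s1" "stage s \<noteq> stage s2"
      using strict_mono_eq[OF strict_mono_stage] by auto
    then show ?thesis using 3 by (simp add: policy_point_def two_stage_def)
  qed
qed

lemma two_stage_point:
  fixes s1 s2 :: "'s::{finite,linorder}" and g1 :: "'i::finite \<Rightarrow> 'v::finite option"
  assumes "s2 < s1" and n: "CARD('i) = CARD('v)" "CARD('s) = CARD('v)"
    and g2: "\<And>S k l. g2 S k = Some l \<Longrightarrow> l \<in> S"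
  shows "policy_point (two_stage s1 s2 g1 g2) =
    (1 / CARD('v)) *\<^sub>R (\<Sum>k\<in>UNIV. match_vec s1 k (g1 k)) +
    (1 / CARD('v)^2) *\<^sub>R
      (\<Sum>k'\<in>UNIV. \<Sum>k\<in>UNIV. match_vec s2 k (g2 (UNIV - set_option (g1 k')) k))"
proof -
  have "(\<Sum>k''\<in>UNIV. match_vec s' k'' (h k'') $ (k, l, s)) =
      of_bool (s = s' \<and> h k = Some l)" for s' s :: 's and h :: "'i \<Rightarrow> 'v option" and k l
  proof -
    have "(\<Sum>k''\<in>UNIV. match_vec s' k'' (h k'') $ (k, l, s)) =
      (\<Sum>k''\<in>UNIV. if k = k'' then of_bool (s = s' \<and> h k = Some l) else 0)"
      by (intro sum.cong) (auto simp: match_vec_nth)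
    then show ?thesis by simp
  qed
  then show ?thesis
    by (auto simp: vec_eq_iff two_stage_point_nth[OF assms] simp del: of_bool_conj sum_of_bool_eq)
qed

section \<open>Dimension of the face\<close>

text \<open>If no nonzero vector is orthogonal to the face, the face spans the space linearly. It
  lies in a hyperplane avoiding 0, so its affine dimension is one less than its linear
  dimension.\<close>

lemma facet_definingI:
  fixes f :: "'a::euclidean_space \<Rightarrow> real"
  assumes "\<And>z. z \<in> P \<Longrightarrow> f z \<le> b" "linear f" "b \<noteq> 0"
    and "\<And>c. (\<And>z. z \<in> P \<Longrightarrow> f z = b \<Longrightarrow> c \<bullet> z = 0) \<Longrightarrow> c = 0"
  shows "facet_defining P f b"
proof -
  let ?F = "{z \<in> P. f z = b}"
  have "dim ?F = DIM('a)"
  proof (rule ccontr)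
    assume "dim ?F \<noteq> DIM('a)"
    then have "dim ?F < DIM('a)" using dim_subset_UNIV[of ?F] by linarith
    then obtain c where "c \<noteq> 0" "span ?F \<subseteq> {z. c \<bullet> z = 0}"
      using lowdim_subset_hyperplane by blast
    then show False using assms(4)[of c] span_superset[of ?F] by blast
  qed
  moreover have "affine hull ?F \<subseteq> {z. f z = b}"
  proof (rule hull_minimal)
    show "affine {z. f z = b}"
      using assms(2)
      by (auto simp: affine_def linear_add linear_scale simp flip: distrib_right)
  qed auto
  then have "0 \<notin> affine hull ?F" using linear_0[OF assms(2)] assms(3) by auto
  \<comment> \<open>Adjoining 0, a point outside the affine hull, raises the affine dimension by
    exactly one and turns it into the linear dimension.\<close>
  moreover have "aff_dim (insert 0 ?F) = int (dim ?F)"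
    by (subst aff_dim_zero) (simp_all add: hull_inc, metis dim_span span_insert_0)
  ultimately show ?thesis
    using assms(1) by (simp add: facet_defining_def aff_dim_insert)
qed

lemma linear_facet_lhs: "linear (\<lambda>z :: real ^ ('i::finite \<times> 'v::finite \<times> 's::{finite,linorder}).
    (\<Sum>\<tau>\<in>{t<..}. \<Sum>k\<in>UNIV. z $ (k, j, \<tau>)) + r * z $ (i, j, t))"
  by (rule linearI) (simp_all add: sum.distrib sum_distrib_left algebra_simps)

text \<open>If \<open>g1\<close> gives \<open>j\<close> to m types, then \<open>j\<close> is matched
  at \<open>s\<close> with probability m/n and survives to \<open>t\<close> with probability (n -
  m)/n. There \<open>i\<close> takes it whenever \<open>i\<close> arrives, so n times that
  probability is again (n - m)/n.\<close>

lemma two_stage_tight: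
  fixes s t :: "'s::{finite,linorder}" and g1 :: "'i::finite \<Rightarrow> 'v::finite option"
  assumes "t < s" and n: "CARD('i) = CARD('v)" "CARD('s) = CARD('v)"
    and g2: "\<And>S k l. g2 S k = Some l \<Longrightarrow> l \<in> S" and i: "\<And>S. j \<in> S \<Longrightarrow> g2 S i = Some j"
  defines "z \<equiv> policy_point (two_stage s t g1 g2) :: real ^ ('i \<times> 'v \<times> 's)"
  shows "(\<Sum>\<tau>\<in>{t<..}. \<Sum>k\<in>UNIV. z $ (k, j, \<tau>)) + real CARD('v) * z $ (i, j, t) = 1"
proof -
  let ?n = "CARD('v)" and ?m = "(\<Sum>k\<in>UNIV. of_bool (g1 k = Some j)) :: real"
  have z: "z $ (k, l, \<tau>) = 1 / ?n * of_bool (\<tau> = s \<and> g1 k = Some l) +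
    1 / ?n^2 * (\<Sum>k'\<in>UNIV. of_bool (\<tau> = t \<and> g2 (UNIV - set_option (g1 k')) k = Some l))" for k l \<tau>
    unfolding z_def using assms by (intro two_stage_point_nth)
  have "(\<Sum>\<tau>\<in>{t<..}. \<Sum>k\<in>UNIV. z $ (k, j, \<tau>)) = (\<Sum>\<tau>\<in>{t<..}. if \<tau> = s then 1 / ?n * ?m else 0)"
  proof (rule sum.cong[OF refl])
    fix \<tau> assume "\<tau> \<in> {t<..}"
    then have "\<tau> \<noteq> t" by auto
    then show "(\<Sum>k\<in>UNIV. z $ (k, j, \<tau>)) = (if \<tau> = s then 1 / ?n * ?m else 0)"
      by (simp add: z sum_distrib_left del: sum_of_bool_eq)
  qed
  then have a: "(\<Sum>\<tau>\<in>{t<..}. \<Sum>k\<in>UNIV. z $ (k, j, \<tau>)) = 1 / ?n * ?m"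
    using assms(1) by simp
  have "g2 (UNIV - set_option (g1 k')) i = Some j \<longleftrightarrow> g1 k' \<noteq> Some j" for k'
    using g2[of "UNIV - set_option (g1 k')" i j] i[of "UNIV - set_option (g1 k')"] by auto
  then have "z $ (i, j, t) = 1 / ?n^2 * (\<Sum>k'\<in>UNIV. 1 - of_bool (g1 k' = Some j))"
    using less_imp_neq[OF assms(1)] by (simp add: z of_bool_not_iff del: sum_of_bool_eq)
  also have "(\<Sum>k'\<in>UNIV. 1 - of_bool (g1 k' = Some j)) = ?n - ?m"
    using n by (simp add: sum_subtractf)
  finally show ?thesis
    unfolding a by (simp add: power2_eq_square field_simps del: sum_of_bool_eq)
qed

text \<open>Orthogonality to a two-stage point, multiplied by n^2 to clear denominators.\<close>

lemma inner_two_stage_point: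
  fixes s1 s2 :: "'s::{finite,linorder}" and g1 :: "'i::finite \<Rightarrow> 'v::finite option"
    and c :: "real ^ ('i \<times> 'v \<times> 's)"
  assumes "s2 < s1" and n: "CARD('i) = CARD('v)" "CARD('s) = CARD('v)"
    and g2: "\<And>S k l. g2 S k = Some l \<Longrightarrow> l \<in> S"
    and "c \<bullet> policy_point (two_stage s1 s2 g1 g2) = 0"
  shows "CARD('v) * (\<Sum>k\<in>UNIV. case g1 k of None \<Rightarrow> 0 | Some l \<Rightarrow> c $ (k, l, s1)) +
    (\<Sum>k'\<in>UNIV. \<Sum>k\<in>UNIV. case g2 (UNIV - set_option (g1 k')) k of
      None \<Rightarrow> 0 | Some l \<Rightarrow> c $ (k, l, s2)) = 0"
proof -
  have "1 / CARD('v) * (\<Sum>k\<in>UNIV. case g1 k of None \<Rightarrow> 0 | Some l \<Rightarrow> c $ (k, l, s1)) +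
    1 / CARD('v)^2 * (\<Sum>k'\<in>UNIV. \<Sum>k\<in>UNIV. case g2 (UNIV - set_option (g1 k')) k of
      None \<Rightarrow> 0 | Some l \<Rightarrow> c $ (k, l, s2)) = c \<bullet> policy_point (two_stage s1 s2 g1 g2)"
    by (subst two_stage_point[where ?g2.0 = g2, OF assms(1-4)])
       (simp_all add: inner_add_right inner_sum_right inner_match_vec)
  then show ?thesis
    using assms(5) by (simp add: field_simps power2_eq_square)
qed

theorem proposition3:
  fixes n :: nat and i :: "'i::finite" and j :: "'v::finite" and t :: "'s::{finite,linorder}"
  assumes "n \<ge> 1" and "CARD('i) = n" and "CARD('v) = n" and "CARD('s) = n"
    and "stage t \<le> n - 1"
  shows "facet_defining (Q :: (real ^ ('i \<times> 'v \<times> 's)) set)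
           (\<lambda>z. (\<Sum>\<tau>\<in>{t<..}. \<Sum>k\<in>UNIV. z $ (k, j, \<tau>)) + real n * z $ (i, j, t)) 1"
proof (rule facet_definingI)
  let ?f = "\<lambda>z :: real ^ ('i \<times> 'v \<times> 's).
    (\<Sum>\<tau>\<in>{t<..}. \<Sum>k\<in>UNIV. z $ (k, j, \<tau>)) + real n * z $ (i, j, t)"
  have n: "CARD('i) = CARD('v)" "CARD('s) = CARD('v)" using assms by simp_all
  show "?f z \<le> 1" if "z \<in> Q" for z
    using Q_valid[OF that n] assms by simp
  show "linear ?f" by (rule linear_facet_lhs)
  have n2: "n \<ge> 2" using assms stage_bounds[of t] by linarith
  \<comment> \<open>Stages count down, so \<open>top\<close> is some stage before \<open>t\<close>
    in time; it exists because \<open>t\<close> is not the first stage.\<close>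
  have "stage t < CARD('s)" using assms by simp
  moreover have "CARD('s) \<in> stage ` (UNIV :: 's set)"
    using bij_betw_stage[where 's = 's] assms(1,4) by (auto simp: bij_betw_def)
  ultimately obtain top :: 's where top: "t < top"
    using strict_mono_less[OF strict_mono_stage, of t] by auto
  fix c :: "real ^ ('i \<times> 'v \<times> 's)"
  assume orth: "\<And>z. z \<in> Q \<Longrightarrow> ?f z = 1 \<Longrightarrow> c \<bullet> z = 0"
  define C where "C s k u = (case u of None \<Rightarrow> 0 | Some l \<Rightarrow> c $ (k, l, s))" for s k u
  have C: "C s k None = 0" "C s k (Some l) = c $ (k, l, s)" for s k l
    by (simp_all add: C_def)
  have C_single: "(\<Sum>k\<in>UNIV. C s k (if k = a then u else None)) = C s a u" for s a u
  proof -
    have "(\<Sum>k\<in>UNIV. C s k (if k = a then u else None)) =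
      (\<Sum>k\<in>UNIV. if k = a then C s a u else 0)"
      by (intro sum.cong) (auto simp: C)
    then show ?thesis by simp
  qed
  have early: "real n * (\<Sum>k\<in>UNIV. C s k (g1 k)) +
      (\<Sum>k'\<in>UNIV. \<Sum>k\<in>UNIV. C t k (g2 (UNIV - set_option (g1 k')) k)) = 0"
    if "t < s" "\<And>S k l. g2 S k = Some l \<Longrightarrow> l \<in> S" "\<And>S. j \<in> S \<Longrightarrow> g2 S i = Some j"
    for s g1 g2
    using inner_two_stage_point[where ?g1.0 = g1 and ?g2.0 = g2, OF that(1) n that(2)
        orth[OF policy_point_in_Q[OF n(2)]]]
      two_stage_tight[where ?g1.0 = g1 and ?g2.0 = g2 and j = j and i = i, OF that(1) n that(2,3)]
      assms(3) by (simp add: C_def)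
  have base: "c $ (i, j, t) = 0"
  proof -
    \<comment> \<open>With nothing matched at \<open>top\<close>, giving \<open>j\<close> to
      \<open>i\<close> at stage \<open>t\<close> is the only action, which isolates this
      coordinate.\<close>
    define g2 where "g2 S k = (if k = i then if j \<in> S then Some j else None else None)" for S k
    have g2: "\<And>S k l. g2 S k = Some l \<Longrightarrow> l \<in> S" "\<And>S. j \<in> S \<Longrightarrow> g2 S i = Some j"
      by (auto simp: g2_def split: if_splits)
    have "(\<Sum>k\<in>UNIV. C t k (g2 UNIV k)) = c $ (i, j, t)"
      unfolding g2_def C_single by (simp add: C)
    then show ?thesis
      using early[where ?g1.0 = "\<lambda>_. None" and ?g2.0 = g2, OF top g2] assms(1,2) by (simp add: C)
  qed
  have later: "c $ (a, l, s) = 0" if "t < s" for a l s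
  proof -
    \<comment> \<open>The reserved match of \<open>i\<close> to \<open>j\<close> at stage
      \<open>t\<close> contributes only the coordinate already known to vanish, so a single match of
      \<open>a\<close> to \<open>l\<close> at \<open>s\<close> is isolated.\<close>
    define g2 where "g2 S k = (if k = i then if j \<in> S then Some j else None else None)" for S k
    have g2: "\<And>S k l. g2 S k = Some l \<Longrightarrow> l \<in> S" "\<And>S. j \<in> S \<Longrightarrow> g2 S i = Some j"
      by (auto simp: g2_def split: if_splits)
    have "(\<Sum>k\<in>UNIV. C t k (g2 S k)) = 0" for S
      unfolding g2_def C_single by (simp add: C base)
    then have "(\<Sum>k\<in>UNIV. C s k (if k = a then Some l else None)) = 0"
      using early[where ?g1.0 = "\<lambda>k. if k = a then Some l else None" and ?g2.0 = g2, OF that g2] assms(1)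
      by simp
    then show ?thesis unfolding C_single by (simp add: C)
  qed
  have same_stage: "c $ (a, l, t) = 0" if "a \<noteq> i" for a l
  proof -
    \<comment> \<open>Only one type arrives per stage, so letting \<open>a\<close> take
      \<open>l\<close> does not interfere with \<open>i\<close> taking \<open>j\<close>, even when
      \<open>l = j\<close>.\<close>
    define g2 where "g2 S k = (if k = i then if j \<in> S then Some j else None
      else if k = a then if l \<in> S then Some l else None else None)" for S k
    have g2: "\<And>S k l. g2 S k = Some l \<Longrightarrow> l \<in> S" "\<And>S. j \<in> S \<Longrightarrow> g2 S i = Some j"
      by (auto simp: g2_def split: if_splits)
    have "(\<Sum>k\<in>UNIV. C t k (g2 UNIV k)) =
      (\<Sum>k\<in>UNIV. C t k (if k = a then Some l else None))"
      by (intro sum.cong) (auto simp: g2_def C base that)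
    then have "(\<Sum>k\<in>UNIV. C t k (g2 UNIV k)) = c $ (a, l, t)"
      unfolding C_single by (simp add: C)
    then show ?thesis
      using early[where ?g1.0 = "\<lambda>_. None" and ?g2.0 = g2, OF top g2] assms(1,2) by (simp add: C)
  qed
  text \<open>The type \<open>i\<close> may use another ad at stage \<open>t\<close> only when \<open>j\<close> is already gone, so \<open>j\<close> is
    first given away at stage \<open>top\<close> with positive probability.\<close>
  have same_type: "c $ (i, l, t) = 0" if "l \<noteq> j" for l
  proof -
    define g1 where "g1 k = (if k = i then Some j else None)" for k
    define g2 where "g2 S k = (if k = i then if j \<in> S then Some j else if l \<in> S then Some l
      else None else None)" for S k
    have g2: "\<And>S k l. g2 S k = Some l \<Longrightarrow> l \<in> S" "\<And>S. j \<in> S \<Longrightarrow> g2 S i = Some j"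
      by (auto simp: g2_def split: if_splits)
    \<comment> \<open>Only \<open>k' = i\<close> removes \<open>j\<close> at \<open>top\<close>, and
      then \<open>i\<close> falls back on \<open>l\<close>, still present as it differs from
      \<open>j\<close>; otherwise \<open>i\<close> takes \<open>j\<close>, with coefficient
      0.\<close>
    have "(\<Sum>k\<in>UNIV. C t k (g2 (UNIV - set_option (g1 k')) k)) =
        (if k' = i then c $ (i, l, t) else 0)" for k'
      unfolding g2_def C_single using that by (simp add: C g1_def base)
    moreover have "(\<Sum>k\<in>UNIV. C top k (g1 k)) = 0"
      unfolding g1_def C_single by (simp add: C later[OF top])
    ultimately show ?thesis
      using early[where ?g1.0 = g1 and ?g2.0 = g2, OF top g2] by simp
  qed
  have earlier: "c $ (a, l, s) = 0" if "s < t" for a l s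
  proof -
    \<comment> \<open>Here \<open>t\<close> is the first active stage and \<open>s\<close> follows
      it in time. Giving \<open>j\<close> to \<open>i\<close> at \<open>t\<close> already makes the
      inequality tight, so \<open>g2\<close> is unrestricted apart from availability.\<close>
    define g1 where "g1 k = (if k = i then Some j else None)" for k
    define g2 where "g2 S k = (if k = a then if l \<in> S then Some l else None else None)" for S k
    have g2: "\<And>S k m. g2 S k = Some m \<Longrightarrow> m \<in> S"
      by (auto simp: g2_def split: if_splits)
    let ?z = "policy_point (two_stage t s g1 g2) :: real ^ ('i \<times> 'v \<times> 's)"
    have z: "?z $ (k, m, \<tau>) = 1 / n * of_bool (\<tau> = t \<and> g1 k = Some m)" if "t \<le> \<tau>" for k m \<tau>
      using that \<open>s < t\<close>
      by (subst two_stage_point_nth[where ?g2.0 = g2, OF \<open>s < t\<close> n g2]) (auto simp: assms(3))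
    have "(\<Sum>\<tau>\<in>{t<..}. \<Sum>k\<in>UNIV. ?z $ (k, j, \<tau>)) = 0"
      by (intro sum.neutral ballI) (auto simp: z dest!: less_imp_neq)
    then have "?f ?z = 1" using assms(1) by (simp add: z g1_def)
    then have "real n * (\<Sum>k\<in>UNIV. C t k (g1 k)) +
      (\<Sum>k'\<in>UNIV. \<Sum>k\<in>UNIV. C s k (g2 (UNIV - set_option (g1 k')) k)) = 0"
      using inner_two_stage_point[where ?g1.0 = g1 and ?g2.0 = g2, OF that n g2
          orth[OF policy_point_in_Q[OF n(2)]]] assms(3) by (simp add: C_def)
    moreover have "(\<Sum>k\<in>UNIV. C t k (g1 k)) = 0"
      unfolding g1_def C_single by (simp add: C base)
    moreover have "(\<Sum>k\<in>UNIV. C s k (g2 (UNIV - set_option (g1 k')) k)) =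
        c $ (a, l, s) - (if k' = i then of_bool (l = j) * c $ (a, l, s) else 0)" for k'
      unfolding g2_def C_single by (simp add: C g1_def)
    \<comment> \<open>Ad \<open>l\<close> is missing at \<open>s\<close> only if
      \<open>l = j\<close> and \<open>i\<close> arrived at \<open>t\<close>, one of n cases; the
      coefficient is at least n - 1, nonzero as n is at least 2.\<close>
    ultimately have "(real n - of_bool (l = j)) * c $ (a, l, s) = 0"
      using assms(2) by (simp add: sum_subtractf left_diff_distrib)
    then show ?thesis using n2 by (cases "l = j") auto
  qed
  have "c $ (a, l, s) = 0" for a l s
    using base later same_stage same_type earlier by (metis linorder_neqE)
  then show "c = 0" by (auto simp: vec_eq_iff)
qed simp

end
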